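(* Let $\lambda$ be a partition and let $I_\lambda\subset R=\mathbb{C}[x,y]$ be the corresponding monomial ideal. Then $I_\lambda$ is supported at the origin, and $$\operatorname{Soc}_0(R/I_\lambda)=\operatorname{Span}_{\mathbb{C}}\{x^iy^j:(i,j)\in C(\lambda)\},$$ where $C(\lambda)$ is the set of removable corners of $D(\lambda)$. In particular, the torus-invariant (not necessarily pointwise torus-fixed) lines in $\operatorname{Soc}_0(R/I_\lambda)$ are exactly the lines spanned by the removable corner monomials $x^iy^j$, $(i,j)\in C(\lambda)$.
   Context: A partition is a finite nonincreasing sequence of positive integers $\lambda=(\lambda_0\ge\cdots\ge\lambda_{r-1}>0)$; its Young diagram is $D(\lambda)=\{(i,j)\in\mathbb{N}^2:0\le j<r,\ 0\le i<\lambda_j\}$ (with $0\in\mathbb{N}$). The corresponding monomial ideal is $I_\lambda=\langle x^iy^j:(i,j)\notin D(\lambda)\rangle\subset R$; the residue classes of $x^iy^j$, $(i,j)\in D(\lambda)$, form a $\mathbb{C}$-basis of $R/I_\lambda$. A box $(i,j)\in D(\lambda)$ is a removable corner if $(i+1,j)\notin D(\lambda)$ and $(i,j+1)\notin D(\lambda)$. "Supported at the origin" means that the support of $R/I_\lambda$ in $\operatorname{Spec}R=\mathbb{A}^2_{\mathbb{C}}$ is contained in $\{0\}$. The local socle at the origin is $\operatorname{Soc}_0(R/I_\lambda)=\{\bar f\in R/I_\lambda:(x,y)\bar f=0\}$. The torus $T=(\mathbb{C}^\times)^2$ acts on $\mathbb{A}^2$ by $(q,t)\cdot(a,b)=(qa,tb)$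 and on $R$ by $((q,t)\cdot f)(x,y)=f(q^{-1}x,t^{-1}y)$, so it acts on $R/I_\lambda$ and its socle; a line is torus-invariant if it is mapped to itself by every element of $T$. *)

theory Defs
  imports
    "HOL-Computational_Algebra.Polynomial"
    "HOL-Algebra.Algebraic_Closure_Type"
    "Jordan_Normal_Form.Missing_VectorSpace"
begin

section \<open>Partitions and Young diagrams\<close>

definition is_partition :: "nat list \<Rightarrow> bool" where
  "is_partition lam \<longleftrightarrow> sorted_wrt (\<ge>) lam \<and> (\<forall>n\<in>set lam. 0 < n)"

definition young_diagram :: "nat list \<Rightarrow> (nat \<times> nat) set" where
  "young_diagram lam = {(i, j). j < length lam \<and> i < lam ! j}"

definition removable_corners :: "nat list \<Rightarrow> (nat \<times> nat) set" where
  "removable_corners lam = {(i, j). (i, j) \<in> young_diagram lam \<and>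
     (i + 1, j) \<notin> young_diagram lam \<and> (i, j + 1) \<notin> young_diagram lam}"


section \<open>The ring of polynomials in two variables\<close>

text \<open>The ring \<open>\<complex>[x,y]\<close> is represented as \<open>\<complex>[x][y]\<close>: the outer polynomial variable is
  \<open>y\<close>, and the coefficients are polynomials in \<open>x\<close>.\<close>

definition Cxy :: "complex poly poly ring" where
  "Cxy = ring_of_type_algebra"

definition xvar :: "complex poly poly" where
  "xvar = [:[:0, 1:]:]"

definition yvar :: "complex poly poly" where
  "yvar = [:0, 1:]"

definition const_poly :: "complex \<Rightarrow> complex poly poly" where
  "const_poly c = [:[:c:]:]"

definition monomial_ideal :: "nat list \<Rightarrow> complex poly poly set" where
  "monomial_ideal lam = Idl\<^bsub>Cxy\<^esub> {xvar ^ i * yvar ^ j | i j. (i, j) \<notin> young_diagram lam}"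

text \<open>The closed point \<open>0\<close> of \<open>\<bbbA>\<^sup>2 = Spec \<complex>[x,y]\<close> is the maximal ideal \<open>(x, y)\<close>.\<close>

definition origin_ideal :: "complex poly poly set" where
  "origin_ideal = Idl\<^bsub>Cxy\<^esub> {xvar, yvar}"


section \<open>Residue class modules\<close>

text \<open>The quotient \<open>R/I\<close> as a module over a ring of scalars that acts through a ring
  homomorphism \<open>\<phi>\<close> into \<open>R\<close>. With \<open>\<phi> = id\<close> this is the \<open>R\<close>-module \<open>R/I\<close>.\<close>

definition quotient_module ::
  "('k \<Rightarrow> 'a) \<Rightarrow> ('a, 'm) ring_scheme \<Rightarrow> 'a set \<Rightarrow> ('k, 'a set) module" where
  "quotient_module \<phi> R I =
     \<lparr>carrier = carrier (R Quot I), monoid.mult = monoid.mult (R Quot I),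
      one = \<one>\<^bsub>R Quot I\<^esub>, zero = \<zero>\<^bsub>R Quot I\<^esub>, add = add (R Quot I),
      module.smult = (\<lambda>c F. (I +>\<^bsub>R\<^esub> \<phi> c) \<otimes>\<^bsub>R Quot I\<^esub> F)\<rparr>"

definition residue_module :: "nat list \<Rightarrow> (complex poly poly, complex poly poly set) module" where
  "residue_module lam = quotient_module id Cxy (monomial_ideal lam)"

definition residue_space :: "nat list \<Rightarrow> (complex, complex poly poly set) module" where
  "residue_space lam = quotient_module const_poly Cxy (monomial_ideal lam)"

definition residue_class :: "nat list \<Rightarrow> complex poly poly \<Rightarrow> complex poly poly set" where
  "residue_class lam f = monomial_ideal lam +>\<^bsub>Cxy\<^esub> f"

definition residue_span :: "nat list \<Rightarrow> complex poly poly set set \<Rightarrow> complex poly poly set set" where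
  "residue_span lam S = module.span (ring_of_type_algebra :: complex ring) (residue_space lam) S"


section \<open>Support of a module\<close>

text \<open>For a prime ideal \<open>P\<close> of \<open>R\<close>, the localization \<open>M\<^sub>P\<close> consists of the fractions \<open>m/s\<close> with
  \<open>s \<notin> P\<close>, where \<open>m/s = m'/s'\<close> iff \<open>u s' m = u s m'\<close> for some \<open>u \<notin> P\<close>.\<close>

definition fraction_rel ::
  "('a, 'm) ring_scheme \<Rightarrow> ('a, 'b, 'n) module_scheme \<Rightarrow> 'a set \<Rightarrow> (('b \<times> 'a) \<times> ('b \<times> 'a)) set" where
  "fraction_rel R M P = {((m, s), (m', s')).
     m \<in> carrier M \<and> m' \<in> carrier M \<and> s \<in> carrier R - P \<and> s' \<in> carrier R - P \<and>
     (\<exists>u \<in> carrier R - P. u \<odot>\<^bsub>M\<^esub> (s' \<odot>\<^bsub>M\<^esub> m) = u \<odot>\<^bsub>M\<^esub> (s \<odot>\<^bsub>M\<^esub> m'))}"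

definition localization_at ::
  "('a, 'm) ring_scheme \<Rightarrow> ('a, 'b, 'n) module_scheme \<Rightarrow> 'a set \<Rightarrow> ('b \<times> 'a) set set" where
  "localization_at R M P = (carrier M \<times> (carrier R - P)) // fraction_rel R M P"

definition module_support ::
  "('a, 'm) ring_scheme \<Rightarrow> ('a, 'b, 'n) module_scheme \<Rightarrow> 'a set set" where
  "module_support R M = {P. primeideal P R \<and>
     localization_at R M P \<noteq> {fraction_rel R M P `` {(\<zero>\<^bsub>M\<^esub>, \<one>\<^bsub>R\<^esub>)}}}"


section \<open>Socle, torus action and invariant lines\<close>

definition socle_at_origin :: "nat list \<Rightarrow> complex poly poly set set" where
  "socle_at_origin lam = {F \<in> carrier (residue_module lam).
     \<forall>g \<in> origin_ideal. g \<odot>\<^bsub>residue_module lam\<^esub> F = \<zero>\<^bsub>residue_module lam\<^esub>}"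

text \<open>\<open>((q,t) \<cdot> f)(x, y) = f(q\<^sup>-\<^sup>1 x, t\<^sup>-\<^sup>1 y)\<close>: the inner composition substitutes for \<open>x\<close> in the
  coefficients, the outer one for \<open>y\<close>.\<close>

definition torus_act :: "complex \<Rightarrow> complex \<Rightarrow> complex poly poly \<Rightarrow> complex poly poly" where
  "torus_act q t f =
     pcompose (map_poly (\<lambda>p. pcompose p [:0, inverse q:]) f) [:0, [:inverse t:]:]"

text \<open>The induced action on \<open>R/I\<^sub>\<lambda>\<close> sends the class of \<open>f\<close> to the class of \<open>(q,t) \<cdot> f\<close>. Because
  monomial ideals are torus-invariant, the class does not depend on the representative, and the
  union below is over a constant family.\<close>

definition torus_act_residue ::
  "nat list \<Rightarrow> complex \<Rightarrow> complex \<Rightarrow> complex poly poly set \<Rightarrow> complex poly poly set" where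
  "torus_act_residue lam q t F = (\<Union>f\<in>F. residue_class lam (torus_act q t f))"

definition is_line :: "nat list \<Rightarrow> complex poly poly set set \<Rightarrow> bool" where
  "is_line lam L \<longleftrightarrow>
     (\<exists>v \<in> carrier (residue_space lam). v \<noteq> \<zero>\<^bsub>residue_space lam\<^esub> \<and> L = residue_span lam {v})"

definition torus_invariant :: "nat list \<Rightarrow> complex poly poly set set \<Rightarrow> bool" where
  "torus_invariant lam L \<longleftrightarrow>
     (\<forall>q t. q \<noteq> 0 \<longrightarrow> t \<noteq> 0 \<longrightarrow> torus_act_residue lam q t ` L = L)"

end

theory Submission
  imports Defs
begin

text \<open>
  Everything is read off from coefficients. Since the Young diagram is closed under decreasing
  either coordinate, the monomials outside it span an ideal, and hence \<open>I\<^sub>\<lambda>\<close> consists of the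
  polynomials whose coefficients vanish on the diagram (\<open>in_monomial_ideal_iff\<close>). A residue class
  is therefore the same thing as a family of coefficients indexed by the diagram
  (\<open>residue_class_eq_iff\<close>).

  Support: an element of \<open>I\<^sub>\<lambda>\<close> outside a prime \<open>P\<close> acts on the localization at \<open>P\<close> both as a
  unit and as zero, so every \<open>P\<close> in the support contains \<open>I\<^sub>\<lambda>\<close>. As \<open>I\<^sub>\<lambda>\<close> contains powers of
  \<open>x\<close> and of \<open>y\<close>, such a \<open>P\<close> contains \<open>(x, y)\<close>, which is maximal.

  Socle: multiplication by \<open>x\<close> or \<open>y\<close> shifts coefficients by one box. The shifted family vanishes
  on the diagram for both variables exactly when every box of the diagram carrying a nonzero
  coefficient has its right and upper neighbours outside the diagram, that is, when every such box
  is a removable corner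
  (\<open>residue_class_in_socle_iff\<close>).

  Invariant lines: \<open>(q, t)\<close> multiplies the coefficient at \<open>(i, j)\<close> by \<open>q\<^sup>-\<^sup>i t\<^sup>-\<^sup>j\<close>
  (\<open>xycoeff_torus_act\<close>), and distinct boxes give distinct characters. So a vector spanning an
  invariant line has only one nonzero coefficient on the diagram
  (\<open>torus_invariant_line_unique_monomial\<close>), and if the line lies in the socle, this
  coefficient sits at a corner.
\<close>

section \<open>Coefficients of polynomials in two variables\<close>

abbreviation xycoeff :: "'a::zero poly poly \<Rightarrow> nat \<Rightarrow> nat \<Rightarrow> 'a" where
  "xycoeff f i j \<equiv> coeff (coeff f j) i"

lemma xvar_power: "xvar ^ i = [:monom 1 i:]"
proof (induction i)
  case (Suc i)
  then show ?case
    by (simp add: xvar_def monom_Suc)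
qed (simp add: pCons_one flip: one_pCons)

lemma yvar_power: "yvar ^ j = monom 1 j"
  by (induction j) (simp_all add: yvar_def monom_Suc)

lemma monomial_eq_monom: "xvar ^ i * yvar ^ j = monom (monom 1 i) j"
  by (simp add: xvar_power yvar_power smult_monom)

lemma const_poly_mult_monom: "const_poly c * monom (monom a i) j = monom (monom (c * a) i) j"
  by (simp add: const_poly_def smult_monom)

lemma const_poly_0: "const_poly 0 = 0"
  by (simp add: const_poly_def)

lemma const_poly_1: "const_poly 1 = 1"
  by (simp add: const_poly_def pCons_one)

lemma const_poly_add: "const_poly (a + b) = const_poly a + const_poly b"
  by (simp add: const_poly_def)

lemma const_poly_mult: "const_poly (a * b) = const_poly a * const_poly b"
  by (simp add: const_poly_def)

lemma xycoeff_monom: "xycoeff (monom (monom c i) j) a b = (if a = i \<and> b = j then c else 0)"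
  by auto

lemma xycoeff_const_poly_mult: "xycoeff (const_poly c * f) i j = c * xycoeff f i j"
  by (simp add: const_poly_def)

lemma xycoeff_mult:
  "xycoeff (f * g) i j = (\<Sum>b\<le>j. \<Sum>a\<le>i. xycoeff f a b * xycoeff g (i - a) (j - b))"
  by (simp add: coeff_mult coeff_sum)

lemma xycoeff_mult_0_0: "xycoeff (f * g) 0 0 = xycoeff f 0 0 * xycoeff g 0 0"
  by (simp add: xycoeff_mult)

lemma xycoeff_xvar_mult: "xycoeff (xvar * f) i j = (if i = 0 then 0 else xycoeff f (i - 1) j)"
  by (cases i) (simp_all add: xvar_def)

lemma xycoeff_yvar_mult: "xycoeff (yvar * f) i j = (if j = 0 then 0 else xycoeff f i (j - 1))"
  by (cases j) (simp_all add: yvar_def)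

lemma sum_mem_additive_closed:
  fixes S :: "'a::comm_monoid_add set"
  assumes "0 \<in> S" "\<And>f g. f \<in> S \<Longrightarrow> g \<in> S \<Longrightarrow> f + g \<in> S" "\<And>k. k \<in> A \<Longrightarrow> h k \<in> S"
  shows "sum h A \<in> S"
  using assms(3) by (induction A rule: infinite_finite_induct) (auto simp: assms(1,2))

text \<open>A polynomial is a finite sum of terms. In this form the fact serves both for membership in an
  ideal and for membership of a residue class in a span; it lets the goal for each term assume that
  its coefficient is nonzero.\<close>

lemma additive_closed_contains_poly:
  fixes f :: "'a::comm_semiring_1 poly poly"
  assumes zero: "0 \<in> S" and add: "\<And>f g. f \<in> S \<Longrightarrow> g \<in> S \<Longrightarrow> f + g \<in> S"
    and terms: "\<And>i j. xycoeff f i j \<noteq> 0 \<Longrightarrow> monom (monom (xycoeff f i j) i) j \<in> S"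
  shows "f \<in> S"
proof -
  have summand: "monom (monom (xycoeff f i j) i) j \<in> S" for i j
    using terms[where i = i and j = j] zero by (cases "xycoeff f i j = 0") auto
  have monom_sum: "monom (sum h A) j = (\<Sum>i\<in>A. monom (h i) j)"
    for h :: "nat \<Rightarrow> 'a poly" and A j
    by (induction A rule: infinite_finite_induct) (simp_all flip: add_monom)
  have "monom (coeff f j) j \<in> S" for j
  proof -
    have "monom (coeff f j) j =
        (\<Sum>i\<le>degree (coeff f j). monom (monom (xycoeff f i j) i) j)"
      by (subst poly_as_sum_of_monoms[of "coeff f j", symmetric]) (rule monom_sum)
    also have "\<dots> \<in> S"
      by (intro sum_mem_additive_closed zero add summand)
    finally show ?thesis .
  qed
  then have "(\<Sum>j\<le>degree f. monom (coeff f j) j) \<in> S"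
    by (intro sum_mem_additive_closed zero add)
  then show ?thesis
    by (simp add: poly_as_sum_of_monoms)
qed


section \<open>Ideals of the polynomial ring\<close>

lemma Cxy_simps [simp]:
  "carrier Cxy = UNIV" "\<zero>\<^bsub>Cxy\<^esub> = 0" "\<one>\<^bsub>Cxy\<^esub> = 1"
  "f \<oplus>\<^bsub>Cxy\<^esub> g = f + g" "f \<otimes>\<^bsub>Cxy\<^esub> g = f * g"
  by (simp_all add: Cxy_def ring_of_type_algebra_def)

lemma complex_ring_simps [simp]:
  "carrier (ring_of_type_algebra :: complex ring) = UNIV"
  "\<zero>\<^bsub>ring_of_type_algebra :: complex ring\<^esub> = 0" "\<one>\<^bsub>ring_of_type_algebra :: complex ring\<^esub> = 1"
  "a \<oplus>\<^bsub>ring_of_type_algebra :: complex ring\<^esub> b = a + b"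
  "a \<otimes>\<^bsub>ring_of_type_algebra :: complex ring\<^esub> b = a * b"
  by (simp_all add: ring_of_type_algebra_def)

lemma cring_Cxy: "cring Cxy"
  unfolding Cxy_def by (rule cring_from_type_algebra)

interpretation Cxy: cring Cxy
  by (rule cring_Cxy)

lemma ideal_CxyI:
  assumes "0 \<in> J" and add: "\<And>f g. f \<in> J \<Longrightarrow> g \<in> J \<Longrightarrow> f + g \<in> J"
    and mult: "\<And>f g. f \<in> J \<Longrightarrow> g * f \<in> J"
  shows "ideal J Cxy"
proof (rule idealI)
  have neg: "\<ominus>\<^bsub>Cxy\<^esub> f = - f" for f
    by (rule Cxy.minus_equality) auto
  show "subgroup J (add_monoid Cxy)"
  proof (rule group.subgroupI)
    show "group (add_monoid Cxy)"
      by (rule Cxy.a_group)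
    show "inv\<^bsub>add_monoid Cxy\<^esub> f \<in> J" if "f \<in> J" for f
      using mult[OF that, of "-1"] neg[of f] by (simp add: a_inv_def)
  qed (use assms in auto)
qed (use mult in \<open>auto simp: mult.commute Cxy.ring_axioms\<close>)

text \<open>For the nontrivial inclusion, splitting off constant coefficients first in \<open>y\<close> and then in
  \<open>x\<close> gives \<open>f = c + x q + y g\<close>, where \<open>c\<close> is the constant coefficient of \<open>f\<close>.\<close>

lemma in_origin_ideal_iff: "f \<in> origin_ideal \<longleftrightarrow> xycoeff f 0 0 = 0"
proof
  have "ideal {f. xycoeff f 0 0 = (0 :: complex)} Cxy"
    by (rule ideal_CxyI) (auto simp: xycoeff_mult_0_0)
  then have "origin_ideal \<subseteq> {f. xycoeff f 0 0 = 0}"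
    unfolding origin_ideal_def
    by (rule Cxy.genideal_minimal) (auto simp: xvar_def yvar_def)
  then show "f \<in> origin_ideal \<Longrightarrow> xycoeff f 0 0 = 0"
    by blast
next
  assume f: "xycoeff f 0 0 = 0"
  interpret ideal origin_ideal Cxy
    unfolding origin_ideal_def by (rule Cxy.genideal_ideal) simp
  have gens: "xvar \<in> origin_ideal" "yvar \<in> origin_ideal"
    unfolding origin_ideal_def using Cxy.genideal_self[of "{xvar, yvar}"] by auto
  obtain p g where p: "f = pCons p g"
    by (rule pCons_cases)
  obtain c q where q: "p = pCons c q"
    by (rule pCons_cases)
  have "f = xvar * [:q:] + yvar * g"
    using f by (simp add: p q xvar_def yvar_def)
  moreover have "xvar * [:q:] + yvar * g \<in> origin_ideal"
    using I_r_closed[OF gens(1), of "[:q:]"] I_r_closed[OF gens(2), of g]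
      a_closed[of "xvar * [:q:]" "yvar * g"]
    by simp
  ultimately show "f \<in> origin_ideal"
    by simp
qed

text \<open>The ideal \<open>(x, y)\<close> is maximal: if \<open>f\<close> has constant coefficient \<open>c \<noteq> 0\<close>, then
  \<open>1 - c\<^sup>-\<^sup>1 f\<close> has none, so \<open>1\<close> lies in the ideal generated by \<open>x\<close>, \<open>y\<close> and \<open>f\<close>.\<close>

lemma proper_ideal_containing_origin_ideal:
  assumes P: "ideal P Cxy" "P \<noteq> UNIV" and gens: "xvar \<in> P" "yvar \<in> P"
  shows "P = origin_ideal"
proof
  interpret ideal P Cxy
    by (rule P(1))
  show sub: "origin_ideal \<subseteq> P"
    unfolding origin_ideal_def by (rule Cxy.genideal_minimal[OF P(1)]) (use gens in simp)
  show "P \<subseteq> origin_ideal"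
  proof (rule subsetI, rule ccontr)
    fix f assume f: "f \<in> P" "f \<notin> origin_ideal"
    let ?c = "xycoeff f 0 0"
    have c: "?c \<noteq> 0"
      using f(2) by (simp add: in_origin_ideal_iff)
    define g where "g = 1 - const_poly (inverse ?c) * f"
    have "g \<in> P"
      using sub c by (auto simp: g_def in_origin_ideal_iff xycoeff_const_poly_mult)
    moreover have "const_poly (inverse ?c) * f \<in> P"
      using I_l_closed[OF f(1), of "const_poly (inverse ?c)"] by simp
    ultimately have "g + const_poly (inverse ?c) * f \<in> P"
      using a_closed by fastforce
    then have "1 \<in> P"
      by (simp add: g_def)
    then show False
      using one_imp_carrier P(2) by simp
  qed
qed


section \<open>The monomial ideal and its residue classes\<close>

lemma young_diagram_downward_closed:
  assumes "is_partition lam" "(i, j) \<in> young_diagram lam" "a \<le> i" "b \<le> j"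
  shows "(a, b) \<in> young_diagram lam"
proof -
  have j: "j < length lam" "i < lam ! j"
    using assms(2) by (auto simp: young_diagram_def)
  have "lam ! j \<le> lam ! b"
    using assms(1,4) j(1) sorted_wrt_nth_less[of "(\<ge>)" lam b j]
    by (cases "b = j") (auto simp: is_partition_def)
  then show ?thesis
    using j assms(3,4) by (auto simp: young_diagram_def)
qed

lemma ideal_monomial_ideal: "ideal (monomial_ideal lam) Cxy"
  unfolding monomial_ideal_def by (rule Cxy.genideal_ideal) simp

lemma monomial_in_monomial_ideal:
  "(i, j) \<notin> young_diagram lam \<Longrightarrow> xvar ^ i * yvar ^ j \<in> monomial_ideal lam"
  unfolding monomial_ideal_def
  using Cxy.genideal_self[of "{xvar ^ i * yvar ^ j | i j. (i, j) \<notin> young_diagram lam}"]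
  by auto

text \<open>The polynomials vanishing on the diagram form an ideal because \<open>xycoeff (g * f) i j\<close> involves
  only coefficients of \<open>f\<close> at boxes weakly below \<open>(i, j)\<close>, which stay inside the diagram. Each
  term of such a polynomial is a multiple of one of the generators.\<close>

lemma in_monomial_ideal_iff:
  assumes "is_partition lam"
  shows "f \<in> monomial_ideal lam \<longleftrightarrow> (\<forall>i j. (i, j) \<in> young_diagram lam \<longrightarrow> xycoeff f i j = 0)"
proof
  have "ideal {f. \<forall>i j. (i, j) \<in> young_diagram lam \<longrightarrow> xycoeff f i j = (0 :: complex)} Cxy"
  proof (rule ideal_CxyI, goal_cases)
    case (3 f g)
    show ?case
    proof clarify
      fix i j assume "(i, j) \<in> young_diagram lam"
      then have "xycoeff f (i - a) (j - b) = 0" for a b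
        using 3 young_diagram_downward_closed[OF assms, of i j "i - a" "j - b"] by auto
      then show "xycoeff (g * f) i j = 0"
        by (simp add: xycoeff_mult)
    qed
  qed auto
  then have "monomial_ideal lam \<subseteq> {f. \<forall>i j. (i, j) \<in> young_diagram lam \<longrightarrow> xycoeff f i j = 0}"
    unfolding monomial_ideal_def
    by (rule Cxy.genideal_minimal) (auto simp: monomial_eq_monom xycoeff_monom)
  then show "f \<in> monomial_ideal lam \<Longrightarrow> \<forall>i j. (i, j) \<in> young_diagram lam \<longrightarrow> xycoeff f i j = 0"
    by blast
next
  assume f: "\<forall>i j. (i, j) \<in> young_diagram lam \<longrightarrow> xycoeff f i j = 0"
  interpret ideal "monomial_ideal lam" Cxy
    by (rule ideal_monomial_ideal)
  show "f \<in> monomial_ideal lam"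
  proof (rule additive_closed_contains_poly)
    show "0 \<in> monomial_ideal lam"
      using zero_closed by simp
    show "g + h \<in> monomial_ideal lam" if "g \<in> monomial_ideal lam" "h \<in> monomial_ideal lam" for g h
      using a_closed[OF that] by simp
    fix i j assume "xycoeff f i j \<noteq> 0"
    then have "xvar ^ i * yvar ^ j \<in> monomial_ideal lam"
      using f by (intro monomial_in_monomial_ideal) auto
    from I_l_closed[OF this, of "const_poly (xycoeff f i j)"]
    show "monom (monom (xycoeff f i j) i) j \<in> monomial_ideal lam"
      by (simp add: monomial_eq_monom const_poly_mult_monom)
  qed
qed

lemma residue_class_eq:
  assumes "is_partition lam"
  shows "residue_class lam f =
    {g. \<forall>i j. (i, j) \<in> young_diagram lam \<longrightarrow> xycoeff g i j = xycoeff f i j}"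
proof -
  have "residue_class lam f = {g. g - f \<in> monomial_ideal lam}"
    unfolding residue_class_def a_r_coset_def' by (force simp: diff_add_cancel)
  then show ?thesis
    by (auto simp: in_monomial_ideal_iff[OF assms])
qed

lemma residue_class_eq_iff:
  assumes "is_partition lam"
  shows "residue_class lam f = residue_class lam g \<longleftrightarrow>
    (\<forall>i j. (i, j) \<in> young_diagram lam \<longrightarrow> xycoeff f i j = xycoeff g i j)"
  by (auto simp: residue_class_eq[OF assms])

lemma zero_Cxy_Quot: "\<zero>\<^bsub>Cxy Quot monomial_ideal lam\<^esub> = residue_class lam 0"
  by (simp add: FactRing_def residue_class_def a_r_coset_def')

text \<open>The left factor is spelled out as a coset because this is how scalars enter
  \<^const>\<open>quotient_module\<close>.\<close>

lemma residue_class_mult: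
  "(monomial_ideal lam +>\<^bsub>Cxy\<^esub> f) \<otimes>\<^bsub>Cxy Quot monomial_ideal lam\<^esub> residue_class lam g =
    residue_class lam (f * g)"
  using ideal.rcoset_mult_add[OF ideal_monomial_ideal]
  by (simp add: FactRing_def residue_class_def)

lemma residue_class_add:
  "residue_class lam f \<oplus>\<^bsub>Cxy Quot monomial_ideal lam\<^esub> residue_class lam g =
    residue_class lam (f + g)"
proof -
  interpret ideal "monomial_ideal lam" Cxy
    by (rule ideal_monomial_ideal)
  show ?thesis
    using a_rcos_sum by (simp add: FactRing_def residue_class_def)
qed

lemma carrier_Cxy_Quot: "carrier (Cxy Quot monomial_ideal lam) = range (residue_class lam)"
  by (auto simp: FactRing_def A_RCOSETS_def' residue_class_def)

lemma residue_module_simps: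
  "carrier (residue_module lam) = range (residue_class lam)"
  "\<zero>\<^bsub>residue_module lam\<^esub> = residue_class lam 0"
  "g \<odot>\<^bsub>residue_module lam\<^esub> residue_class lam f = residue_class lam (g * f)"
  by (simp_all add: residue_module_def quotient_module_def carrier_Cxy_Quot zero_Cxy_Quot
      residue_class_mult)

lemma residue_space_simps:
  "carrier (residue_space lam) = range (residue_class lam)"
  "\<zero>\<^bsub>residue_space lam\<^esub> = residue_class lam 0"
  "residue_class lam f \<oplus>\<^bsub>residue_space lam\<^esub> residue_class lam g = residue_class lam (f + g)"
  "c \<odot>\<^bsub>residue_space lam\<^esub> residue_class lam f = residue_class lam (const_poly c * f)"
  by (simp_all add: residue_space_def quotient_module_def carrier_Cxy_Quot zero_Cxy_Quot
      residue_class_mult residue_class_add)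

lemma module_residue_space: "module (ring_of_type_algebra :: complex ring) (residue_space lam)"
proof (rule moduleI)
  show "cring (ring_of_type_algebra :: complex ring)"
    by (rule cring_from_type_algebra)
  show "abelian_group (residue_space lam)"
  proof (rule abelian_groupI)
    fix F assume "F \<in> carrier (residue_space lam)"
    then obtain f where F: "F = residue_class lam f"
      by (auto simp: residue_space_simps)
    show "\<exists>G\<in>carrier (residue_space lam). G \<oplus>\<^bsub>residue_space lam\<^esub> F = \<zero>\<^bsub>residue_space lam\<^esub>"
      by (rule bexI[of _ "residue_class lam (- f)"]) (auto simp: F residue_space_simps)
  qed (auto simp: residue_space_simps algebra_simps)
qed (auto simp: residue_space_simps const_poly_1 const_poly_add const_poly_mult algebra_simps)

interpretation residue_space:
  module "ring_of_type_algebra :: complex ring" "residue_space lam" for lam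
  by (rule module_residue_space)

lemma submodule_residue_spaceI:
  assumes "residue_class lam 0 \<in> N" "N \<subseteq> range (residue_class lam)"
    and "\<And>f g. residue_class lam f \<in> N \<Longrightarrow> residue_class lam g \<in> N \<Longrightarrow>
      residue_class lam (f + g) \<in> N"
    and "\<And>c f. residue_class lam f \<in> N \<Longrightarrow> residue_class lam (const_poly c * f) \<in> N"
  shows "submodule (ring_of_type_algebra :: complex ring) N (residue_space lam)"
proof
  show "N \<subseteq> carrier (residue_space lam)" "\<zero>\<^bsub>residue_space lam\<^esub> \<in> N"
    using assms(1,2) by (simp_all add: residue_space_simps)
  show "v \<oplus>\<^bsub>residue_space lam\<^esub> w \<in> N" if vw: "v \<in> N" "w \<in> N" for v w
  proof -
    obtain f g where "v = residue_class lam f" "w = residue_class lam g"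
      using vw assms(2) by blast
    then show ?thesis
      using vw assms(3) by (simp add: residue_space_simps)
  qed
  show "c \<odot>\<^bsub>residue_space lam\<^esub> v \<in> N" if v: "v \<in> N" for c v
  proof -
    obtain f where "v = residue_class lam f"
      using v assms(2) by blast
    then show ?thesis
      using v assms(4) by (simp add: residue_space_simps)
  qed
qed

lemma residue_span_closed:
  assumes "S \<subseteq> range (residue_class lam)"
  shows "residue_class lam 0 \<in> residue_span lam S"
    and "residue_class lam f \<in> residue_span lam S \<Longrightarrow> residue_class lam g \<in> residue_span lam S \<Longrightarrow>
      residue_class lam (f + g) \<in> residue_span lam S"
    and "residue_class lam f \<in> residue_span lam S \<Longrightarrow>
      residue_class lam (const_poly c * f) \<in> residue_span lam S"
    and "S \<subseteq> residue_span lam S"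
    and "residue_span lam S \<subseteq> range (residue_class lam)"
proof -
  have S: "S \<subseteq> carrier (residue_space lam)"
    using assms by (simp add: residue_space_simps)
  interpret submodule "ring_of_type_algebra :: complex ring" "residue_span lam S" "residue_space lam"
    unfolding residue_span_def by (rule residue_space.span_is_submodule[OF S])
  show "S \<subseteq> residue_span lam S"
    unfolding residue_span_def by (rule residue_space.in_own_span[OF S])
  show "residue_class lam 0 \<in> residue_span lam S" "residue_span lam S \<subseteq> range (residue_class lam)"
    using zero_closed subset by (simp_all add: residue_space_simps)
  show "residue_class lam (f + g) \<in> residue_span lam S"
    if "residue_class lam f \<in> residue_span lam S" "residue_class lam g \<in> residue_span lam S"
    using m_closed[OF that] by (simp add: residue_space_simps)
  show "residue_class lam (const_poly c * f) \<in> residue_span lam S"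
    if "residue_class lam f \<in> residue_span lam S"
    using smult_closed[OF _ that, of c] by (simp add: residue_space_simps)
qed

lemma residue_span_minimal:
  assumes "submodule (ring_of_type_algebra :: complex ring) N (residue_space lam)" "S \<subseteq> N"
  shows "residue_span lam S \<subseteq> N"
  unfolding residue_span_def by (rule residue_space.span_is_subset[OF assms(2,1)])

lemma residue_span_singleton:
  "residue_span lam {residue_class lam f} = range (\<lambda>c. residue_class lam (const_poly c * f))"
proof
  let ?N = "range (\<lambda>c. residue_class lam (const_poly c * f))"
  have add: "residue_class lam (g + h) \<in> ?N"
    if gh: "residue_class lam g \<in> ?N" "residue_class lam h \<in> ?N" for g h
  proof -
    obtain a b where "residue_class lam g = residue_class lam (const_poly a * f)"
      "residue_class lam h = residue_class lam (const_poly b * f)"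
      using gh by blast
    then have "residue_class lam (g + h) = residue_class lam (const_poly (a + b) * f)"
      by (metis residue_space_simps(3) const_poly_add distrib_right)
    then show ?thesis
      by blast
  qed
  have smult: "residue_class lam (const_poly c * g) \<in> ?N" if g: "residue_class lam g \<in> ?N" for c g
  proof -
    obtain a where "residue_class lam g = residue_class lam (const_poly a * f)"
      using g by blast
    then have "residue_class lam (const_poly c * g) = residue_class lam (const_poly (c * a) * f)"
      by (metis residue_space_simps(4) const_poly_mult mult.assoc)
    then show ?thesis
      by blast
  qed
  have gen: "residue_class lam f \<in> ?N" "residue_class lam 0 \<in> ?N"
    by (rule range_eqI[of _ _ 1], simp add: const_poly_1)
      (rule range_eqI[of _ _ 0], simp add: const_poly_0)
  show "residue_span lam {residue_class lam f} \<subseteq> ?N"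
    by (intro residue_span_minimal submodule_residue_spaceI) (use add smult gen in auto)
  show "?N \<subseteq> residue_span lam {residue_class lam f}"
    using residue_span_closed(3,4)[of "{residue_class lam f}" lam] by blast
qed

text \<open>The classes of the monomials in the diagram are linearly independent modulo \<open>I\<^sub>\<lambda>\<close>, so the
  span of a subfamily is determined by where coefficients have to vanish. Indices in \<open>K\<close> outside
  the diagram contribute only the zero class.\<close>

lemma residue_span_monomials:
  assumes lam: "is_partition lam"
  shows "residue_span lam {residue_class lam (xvar ^ i * yvar ^ j) | i j. (i, j) \<in> K} =
    residue_class lam ` {f. \<forall>i j. (i, j) \<in> young_diagram lam - K \<longrightarrow> xycoeff f i j = 0}"
    (is "residue_span lam ?S = residue_class lam ` ?V")
proof
  have S: "?S \<subseteq> range (residue_class lam)"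
    by blast
  have V: "residue_class lam f \<in> residue_class lam ` ?V \<longleftrightarrow> f \<in> ?V" for f
    by (auto simp: residue_class_eq_iff[OF lam])
  show "residue_span lam ?S \<subseteq> residue_class lam ` ?V"
  proof (rule residue_span_minimal[OF submodule_residue_spaceI])
    show "?S \<subseteq> residue_class lam ` ?V"
      by (auto simp: monomial_eq_monom xycoeff_monom)
  qed (unfold V, auto simp: xycoeff_const_poly_mult)
  show "residue_class lam ` ?V \<subseteq> residue_span lam ?S"
  proof (rule image_subsetI)
    fix f assume f: "f \<in> ?V"
    have "f \<in> {g. residue_class lam g \<in> residue_span lam ?S}"
    proof (rule additive_closed_contains_poly)
      fix i j assume nz: "xycoeff f i j \<noteq> 0"
      show "monom (monom (xycoeff f i j) i) j \<in> {g. residue_class lam g \<in> residue_span lam ?S}"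
      proof (cases "(i, j) \<in> young_diagram lam")
        case True
        with nz f have "residue_class lam (xvar ^ i * yvar ^ j) \<in> ?S"
          by auto
        then have "residue_class lam (xvar ^ i * yvar ^ j) \<in> residue_span lam ?S"
          using residue_span_closed(4)[OF S] by blast
        from residue_span_closed(3)[OF S this, of "xycoeff f i j"] show ?thesis
          by (simp add: monomial_eq_monom const_poly_mult_monom)
      next
        case False
        then have "residue_class lam (monom (monom (xycoeff f i j) i) j) = residue_class lam 0"
          by (auto simp: residue_class_eq_iff[OF lam] xycoeff_monom)
        then show ?thesis
          using residue_span_closed(1)[OF S] by simp
      qed
    qed (use residue_span_closed(1,2)[OF S] in auto)
    then show "residue_class lam f \<in> residue_span lam ?S"
      by simp
  qed
qed


section \<open>Support\<close>

text \<open>If \<open>a\<close> annihilates the module and \<open>a \<notin> P\<close>, then \<open>a\<close> is a common witness \<open>u\<close> for the equality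
  of any two fractions, so the localization collapses to the class of \<open>0/1\<close>.\<close>

lemma support_contains_annihilator:
  assumes P: "P \<in> module_support Cxy (residue_module lam)"
  shows "monomial_ideal lam \<subseteq> P"
proof (rule subsetI, rule ccontr)
  fix a assume a: "a \<in> monomial_ideal lam" "a \<notin> P"
  interpret I: ideal "monomial_ideal lam" Cxy
    by (rule ideal_monomial_ideal)
  have "primeideal P Cxy"
    using P by (simp add: module_support_def)
  then interpret P: primeideal P Cxy .
  let ?M = "residue_module lam"
  let ?A = "carrier ?M \<times> (carrier Cxy - P)"
  have kill: "residue_class lam (a * f) = residue_class lam 0" for f
  proof -
    have "a * f \<in> monomial_ideal lam"
      using I.I_r_closed[OF a(1), of f] by simp
    then have "residue_class lam (a * f) = monomial_ideal lam"
      unfolding residue_class_def by (rule I.a_rcos_const)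
    also have "\<dots> = residue_class lam 0"
      using zero_Cxy_Quot by (simp add: FactRing_def)
    finally show ?thesis .
  qed
  have "fraction_rel Cxy ?M P = ?A \<times> ?A"
    unfolding fraction_rel_def using a(2)
    by (auto simp: residue_module_simps(1,3) kill intro!: bexI[of _ a])
  moreover have "(\<zero>\<^bsub>?M\<^esub>, \<one>\<^bsub>Cxy\<^esub>) \<in> ?A"
    using P.I_notcarr P.one_imp_carrier by (auto simp: residue_module_simps)
  ultimately have "localization_at Cxy ?M P = {fraction_rel Cxy ?M P `` {(\<zero>\<^bsub>?M\<^esub>, \<one>\<^bsub>Cxy\<^esub>)}}"
    unfolding localization_at_def quotient_def by auto
  then show False
    using P by (simp add: module_support_def)
qed

lemma primeideal_power_mem:
  assumes "primeideal P Cxy" "f ^ n \<in> P"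
  shows "f \<in> P"
proof -
  interpret primeideal P Cxy
    by (rule assms(1))
  show ?thesis
    using assms(2)
  proof (induction n)
    case 0
    then show ?case
      using one_imp_carrier by auto
  next
    case (Suc n)
    then show ?case
      using I_prime[of f "f ^ n"] by auto
  qed
qed

lemma module_support_residue_module: "module_support Cxy (residue_module lam) \<subseteq> {origin_ideal}"
proof
  fix P assume P: "P \<in> module_support Cxy (residue_module lam)"
  then have prime: "primeideal P Cxy"
    by (simp add: module_support_def)
  then interpret primeideal P Cxy .
  \<comment> \<open>The first row has length \<open>n\<close> and there are \<open>length lam\<close> rows, so \<open>x\<^sup>n\<close> and
    \<open>y\<close> to the power \<open>length lam\<close> lie in the ideal.\<close>
  define n where "n = (if lam = [] then 0 else lam ! 0)"
  have "(n, 0) \<notin> young_diagram lam" "(0, length lam) \<notin> young_diagram lam"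
    by (auto simp: young_diagram_def n_def)
  then have "xvar ^ n * yvar ^ 0 \<in> P" "xvar ^ 0 * yvar ^ length lam \<in> P"
    using monomial_in_monomial_ideal support_contains_annihilator[OF P] by blast+
  then have "xvar \<in> P" "yvar \<in> P"
    using primeideal_power_mem[OF prime] by auto
  then show "P \<in> {origin_ideal}"
    using proper_ideal_containing_origin_ideal[OF ideal_axioms] I_notcarr by auto
qed


section \<open>Socle\<close>

text \<open>Being killed by \<open>x\<close> and by \<open>y\<close> forces the coefficient at a box to vanish as soon as its right or
  upper neighbour is in the diagram. Conversely, for \<open>g\<close> without constant term the coefficient
  \<open>xycoeff (g * f) i j\<close> at a box of the diagram depends on \<open>f\<close> only at boxes from which
  one can move right or up without leaving the diagram, hence at boxes that are not corners.\<close>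

lemma residue_class_in_socle_iff:
  assumes lam: "is_partition lam"
  shows "residue_class lam f \<in> socle_at_origin lam \<longleftrightarrow>
    (\<forall>i j. (i, j) \<in> young_diagram lam - removable_corners lam \<longrightarrow> xycoeff f i j = 0)"
proof
  assume "residue_class lam f \<in> socle_at_origin lam"
  then have kill: "residue_class lam (g * f) = residue_class lam 0" if "xycoeff g 0 0 = 0" for g
    using that by (auto simp: socle_at_origin_def in_origin_ideal_iff residue_module_simps)
  have "residue_class lam (xvar * f) = residue_class lam 0"
    "residue_class lam (yvar * f) = residue_class lam 0"
    by (rule kill, simp add: xvar_def yvar_def)+
  note kill_vars = this[unfolded residue_class_eq_iff[OF lam]]
  have "xycoeff (xvar * f) (i + 1) j = 0" if "(i + 1, j) \<in> young_diagram lam" for i j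
    using that kill_vars(1) by simp
  moreover have "xycoeff (yvar * f) i (j + 1) = 0" if "(i, j + 1) \<in> young_diagram lam" for i j
    using that kill_vars(2) by simp
  ultimately show "\<forall>i j. (i, j) \<in> young_diagram lam - removable_corners lam \<longrightarrow> xycoeff f i j = 0"
    by (auto simp: removable_corners_def xycoeff_xvar_mult xycoeff_yvar_mult)
next
  assume f: "\<forall>i j. (i, j) \<in> young_diagram lam - removable_corners lam \<longrightarrow> xycoeff f i j = 0"
  have "xycoeff (g * f) i j = 0" if g: "xycoeff g 0 0 = 0" and ij: "(i, j) \<in> young_diagram lam" for g i j
  proof -
    have "xycoeff g a b * xycoeff f (i - a) (j - b) = 0" if "a \<le> i" "b \<le> j" for a b
    proof (cases "a = 0 \<and> b = 0")
      case False
      then have "i - a + 1 \<le> i \<and> j - b \<le> j \<or> i - a \<le> i \<and> j - b + 1 \<le> j"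
        using that by auto
      then have "(i - a + 1, j - b) \<in> young_diagram lam \<or> (i - a, j - b + 1) \<in> young_diagram lam"
        using young_diagram_downward_closed[OF lam ij] by blast
      then have "(i - a, j - b) \<in> young_diagram lam - removable_corners lam"
        using young_diagram_downward_closed[OF lam ij, of "i - a" "j - b"]
        by (auto simp: removable_corners_def)
      then show ?thesis
        using f by simp
    qed (use g in simp)
    then show ?thesis
      unfolding xycoeff_mult by (intro sum.neutral ballI) simp
  qed
  then show "residue_class lam f \<in> socle_at_origin lam"
    by (auto simp: socle_at_origin_def residue_module_simps in_origin_ideal_iff
        residue_class_eq_iff[OF lam])
qed

lemma socle_at_origin_eq_span:
  assumes lam: "is_partition lam"
  shows "socle_at_origin lam = residue_span lam {residue_class lam (xvar ^ i * yvar ^ j) | i j.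
    (i, j) \<in> removable_corners lam}"
proof -
  have "socle_at_origin lam \<subseteq> range (residue_class lam)"
    by (auto simp: socle_at_origin_def residue_module_simps)
  then show ?thesis
    unfolding residue_span_monomials[OF lam]
    using residue_class_in_socle_iff[OF lam] by blast
qed


section \<open>Torus-invariant lines\<close>

lemma range_comp_surj: "surj h \<Longrightarrow> range (\<lambda>x. F (h x)) = range F"
  unfolding image_image[of F h UNIV, symmetric] by simp

lemma xycoeff_torus_act:
  "xycoeff (torus_act q t f) i j = inverse q ^ i * inverse t ^ j * xycoeff f i j"
proof -
  have const: "[:c:] ^ n = [:c ^ n:]" for c :: complex and n
    by (induction n) auto
  show ?thesis
    unfolding torus_act_def coeff_pcompose_linear const
    by (simp add: coeff_map_poly coeff_pcompose_linear mult_ac)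
qed

text \<open>The torus rescales coefficients one by one, so the coefficients on the diagram of the image
  depend only on the coefficients on the diagram of the argument.\<close>

lemma torus_act_residue_class:
  assumes lam: "is_partition lam"
  shows "torus_act_residue lam q t (residue_class lam f) = residue_class lam (torus_act q t f)"
proof -
  have "residue_class lam (torus_act q t g) = residue_class lam (torus_act q t f)"
    if "g \<in> residue_class lam f" for g
    using that by (auto simp: residue_class_eq[OF lam] xycoeff_torus_act)
  moreover have "f \<in> residue_class lam f"
    by (simp add: residue_class_eq[OF lam])
  ultimately show ?thesis
    unfolding torus_act_residue_def by blast
qed

lemma torus_invariant_line_monomial:
  assumes lam: "is_partition lam"
  shows "torus_invariant lam (residue_span lam {residue_class lam (xvar ^ i * yvar ^ j)})"
proof -
  let ?L = "residue_span lam {residue_class lam (xvar ^ i * yvar ^ j)}"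
  have act: "torus_act_residue lam q t (residue_class lam (const_poly c * (xvar ^ i * yvar ^ j))) =
      residue_class lam (const_poly (inverse q ^ i * inverse t ^ j * c) * (xvar ^ i * yvar ^ j))"
    for q t c
    by (auto simp: torus_act_residue_class[OF lam] residue_class_eq_iff[OF lam] xycoeff_torus_act
        monomial_eq_monom const_poly_mult_monom xycoeff_monom)
  have "torus_act_residue lam q t ` ?L = ?L" if "q \<noteq> 0" "t \<noteq> 0" for q t
  proof -
    have "surj (\<lambda>c. inverse q ^ i * inverse t ^ j * c)"
      by (rule surjI[of _ "\<lambda>c. q ^ i * t ^ j * c"]) (use that in \<open>simp add: field_simps\<close>)
    then show ?thesis
      unfolding residue_span_singleton image_image act by (rule range_comp_surj)
  qed
  then show ?thesis
    by (simp add: torus_invariant_def)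
qed

text \<open>Invariance makes the spanning vector an eigenvector of every torus element, so the characters
  of any two boxes with a nonzero coefficient agree. The torus elements \<open>(2, 1)\<close> and \<open>(1, 2)\<close>
  already tell distinct boxes apart, because 2 is not a root of unity.\<close>

lemma torus_invariant_line_unique_monomial:
  assumes lam: "is_partition lam"
    and inv: "torus_invariant lam (residue_span lam {residue_class lam f})"
    and ij: "(i, j) \<in> young_diagram lam" "xycoeff f i j \<noteq> 0"
    and ab: "(a, b) \<in> young_diagram lam" "xycoeff f a b \<noteq> 0"
  shows "(a, b) = (i, j)"
proof -
  let ?L = "residue_span lam {residue_class lam f}"
  have eq: "inverse q ^ i * inverse t ^ j = inverse q ^ a * inverse t ^ b"
    if "q \<noteq> 0" "t \<noteq> 0" for q t :: complex
  proof -
    have "residue_class lam f \<in> ?L"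
      using residue_span_closed(4)[of "{residue_class lam f}" lam] by simp
    then have "torus_act_residue lam q t (residue_class lam f) \<in> ?L"
      using inv that unfolding torus_invariant_def by blast
    then obtain c where "residue_class lam (torus_act q t f) = residue_class lam (const_poly c * f)"
      unfolding torus_act_residue_class[OF lam] residue_span_singleton by blast
    then have "inverse q ^ i * inverse t ^ j * xycoeff f i j = c * xycoeff f i j"
      "inverse q ^ a * inverse t ^ b * xycoeff f a b = c * xycoeff f a b"
      using ij(1) ab(1)
      by (simp_all add: residue_class_eq_iff[OF lam] xycoeff_torus_act xycoeff_const_poly_mult)
    then show ?thesis
      using ij(2) ab(2) by simp
  qed
  have two: "m = n" if "(1 / 2) ^ m = ((1 / 2) ^ n :: complex)" for m n
  proof -
    have "(2 :: complex) ^ m = 2 ^ n"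
      using that by (simp add: power_one_over)
    then have "of_nat (2 ^ m) = (of_nat (2 ^ n) :: complex)"
      by simp
    then show ?thesis
      by (simp only: of_nat_eq_iff) simp
  qed
  from eq[of 2 1] eq[of 1 2] show ?thesis
    using two by simp
qed

lemma torus_invariant_socle_lines:
  assumes lam: "is_partition lam"
  shows "{L. is_line lam L \<and> L \<subseteq> socle_at_origin lam \<and> torus_invariant lam L} =
    {residue_span lam {residue_class lam (xvar ^ i * yvar ^ j)} | i j. (i, j) \<in> removable_corners lam}"
    (is "?Lines = ?Corners")
proof
  show "?Lines \<subseteq> ?Corners"
  proof
    fix L assume "L \<in> ?Lines"
    then obtain f where L: "L = residue_span lam {residue_class lam f}"
      and nz: "residue_class lam f \<noteq> residue_class lam 0"
      and socle: "L \<subseteq> socle_at_origin lam" and inv: "torus_invariant lam L"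
      by (auto simp: is_line_def residue_space_simps)
    obtain i j where ij: "(i, j) \<in> young_diagram lam" "xycoeff f i j \<noteq> 0"
      using nz by (auto simp: residue_class_eq_iff[OF lam])
    have "residue_class lam f \<in> socle_at_origin lam"
      using socle residue_span_closed(4)[of "{residue_class lam f}" lam] by (auto simp: L)
    then have corner: "(i, j) \<in> removable_corners lam"
      using ij by (auto simp: residue_class_in_socle_iff[OF lam])
    define c where "c = xycoeff f i j"
    have f: "residue_class lam (const_poly d * f) =
        residue_class lam (const_poly (d * c) * (xvar ^ i * yvar ^ j))" for d
      using torus_invariant_line_unique_monomial[OF lam inv[unfolded L] ij]
      by (auto simp: residue_class_eq_iff[OF lam] monomial_eq_monom const_poly_mult_monom
          xycoeff_monom xycoeff_const_poly_mult c_def)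
    have "surj (\<lambda>d. d * c)"
      by (rule surjI[of _ "\<lambda>d. d / c"]) (use ij in \<open>simp add: c_def\<close>)
    then have "L = residue_span lam {residue_class lam (xvar ^ i * yvar ^ j)}"
      unfolding L residue_span_singleton f
      by (rule range_comp_surj)
    then show "L \<in> ?Corners"
      using corner by blast
  qed
  show "?Corners \<subseteq> ?Lines"
  proof clarify
    fix i j assume corner: "(i, j) \<in> removable_corners lam"
    let ?m = "residue_class lam (xvar ^ i * yvar ^ j)"
    have "?m \<noteq> residue_class lam 0"
      using corner
      by (auto simp: residue_class_eq_iff[OF lam] monomial_eq_monom xycoeff_monom
          removable_corners_def)
    then have "is_line lam (residue_span lam {?m})"
      by (auto simp: is_line_def residue_space_simps)
    moreover have "residue_span lam {?m} \<subseteq> socle_at_origin lam"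
      unfolding residue_span_singleton using corner
      by (auto simp: residue_class_in_socle_iff[OF lam] monomial_eq_monom const_poly_mult_monom
          xycoeff_monom)
    ultimately show "is_line lam (residue_span lam {?m}) \<and>
        residue_span lam {?m} \<subseteq> socle_at_origin lam \<and> torus_invariant lam (residue_span lam {?m})"
      using torus_invariant_line_monomial[OF lam] by blast
  qed
qed

theorem proposition5p7:
  fixes lam :: "nat list"
  assumes "is_partition lam"
  shows "module_support Cxy (residue_module lam) \<subseteq> {origin_ideal} \<and>
    socle_at_origin lam =
      residue_span lam {residue_class lam (xvar ^ i * yvar ^ j) | i j.
        (i, j) \<in> removable_corners lam} \<and>
    {L. is_line lam L \<and> L \<subseteq> socle_at_origin lam \<and> torus_invariant lam L} =
      {residue_span lam {residue_class lam (xvar ^ i * yvar ^ j)} | i j.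
        (i, j) \<in> removable_corners lam}"
  using module_support_residue_module socle_at_origin_eq_span[OF assms]
    torus_invariant_socle_lines[OF assms]
  by blast

end
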